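(* Let $(\mathcal M,g)$ be an $(n+1)$-dimensional pseudo-Riemannian manifold. Assume there is a non-isotropic vector field $\xi$, $g(\xi,\xi)\neq0$, with Jacobi operator $J_\xi$ of maximal rank. If $\alpha\neq0$ is a parallel differential quadratic form, then it is proportional to the metric tensor, $\alpha=c\,g$, where $c$ denotes the proportionality factor.
   Context: $\nabla$ is the Levi-Civita connection of $g$, with curvature $R_{XY}Z=\nabla_X\nabla_YZ-\nabla_Y\nabla_XZ-\nabla_{[X,Y]}Z$. The Jacobi operator of a vector field $\xi$ is the $(1,1)$-tensor field $J_\xi:X\mapsto R_{X\xi}\xi$. Its rank is always less than $\dim\mathcal M=n+1$; maximal rank means that the dimension of the image of $J_\xi$ equals $n$. A parallel differential quadratic form is $X\mapsto\alpha(X,X)$ for a symmetric $(0,2)$-tensor field $\alpha$, $\alpha(X,Y)=\alpha(Y,X)$, with $\nabla\alpha=0$; the form is identified with the tensor field $\alpha$. *)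

theory Defs
  imports "HOL-Analysis.Analysis" "HOL-Library.Function_Algebras"
begin

text \<open>
  Functions with values in a real vector space form a real vector space under the pointwise
  operations. In particular \<^const>\<open>dim\<close> applies to sets of tangent vectors, which are
  functionals on smooth functions.
\<close>

instantiation "fun" :: (type, real_vector) real_vector
begin

definition scaleR_fun :: "real \<Rightarrow> ('a \<Rightarrow> 'b) \<Rightarrow> 'a \<Rightarrow> 'b"
  where "scaleR_fun r f = (\<lambda>x. r *\<^sub>R f x)"

instance
  by standard (simp_all add: scaleR_fun_def fun_eq_iff scaleR_add_right scaleR_add_left)

end

text \<open>For open \<open>S\<close> in a Euclidean space, \<open>C_k_on k S f\<close> says that \<open>f\<close> is \<open>k\<close> times
  continuously differentiable on \<open>S\<close>: all iterated directional derivatives up to order \<open>k\<close>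
  exist and are continuous.\<close>

primrec C_k_on :: "nat \<Rightarrow> 'a::real_normed_vector set \<Rightarrow> ('a \<Rightarrow> 'b::real_normed_vector) \<Rightarrow> bool"
where
  "C_k_on 0 S f \<longleftrightarrow> continuous_on S f"
| "C_k_on (Suc k) S f \<longleftrightarrow>
     (\<forall>x\<in>S. f differentiable (at x)) \<and> (\<forall>v. C_k_on k S (\<lambda>x. frechet_derivative f (at x) v))"

definition smooth_on :: "'a::real_normed_vector set \<Rightarrow> ('a \<Rightarrow> 'b::real_normed_vector) \<Rightarrow> bool"
  where "smooth_on S f \<longleftrightarrow> (\<forall>k. C_k_on k S f)"

text \<open>The manifold is the whole type \<open>'m\<close>; a chart is a pair of its domain and coordinate map.
  Values of the coordinate map outside the domain are irrelevant. The atlas need not be maximal.\<close>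

type_synonym ('m, 'e) chart = "'m set \<times> ('m \<Rightarrow> 'e)"

definition is_chart :: "('m::topological_space, 'e::euclidean_space) chart \<Rightarrow> bool"
  where "is_chart = (\<lambda>(U, \<phi>).
    open U \<and> open (\<phi> ` U) \<and> homeomorphism U (\<phi> ` U) \<phi> (inv_into U \<phi>))"

definition smooth_atlas ::
    "('m::{t2_space,second_countable_topology}, 'e::euclidean_space) chart set \<Rightarrow> bool"
  where "smooth_atlas A \<longleftrightarrow>
    (\<forall>C\<in>A. is_chart C) \<and>
    (\<Union>C\<in>A. fst C) = UNIV \<and>
    (\<forall>(U, \<phi>)\<in>A. \<forall>(V, \<psi>)\<in>A. smooth_on (\<phi> ` (U \<inter> V)) (\<psi> \<circ> inv_into U \<phi>))"

definition smooth_functions :: "('m, 'e::euclidean_space) chart set \<Rightarrow> ('m \<Rightarrow> real) set"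
  where "smooth_functions A = {f. \<forall>(U, \<phi>)\<in>A. smooth_on (\<phi> ` U) (f \<circ> inv_into U \<phi>)}"

text \<open>A tangent vector at \<open>p\<close> is a derivation \<open>f \<mapsto> \<Sum>\<^sub>i e\<^sub>i \<partial>f/\<partial>x\<^sub>i(p)\<close> of the algebra of smooth
  functions. It is extended by 0 to non-smooth \<open>f\<close>, so that equality of tangent vectors is
  equality of functionals.\<close>

type_synonym 'm tangent_vector = "('m \<Rightarrow> real) \<Rightarrow> real"
type_synonym 'm vector_field = "'m \<Rightarrow> 'm tangent_vector"
type_synonym 'm tensor02 = "'m \<Rightarrow> 'm tangent_vector \<Rightarrow> 'm tangent_vector \<Rightarrow> real"
type_synonym 'm connection = "'m vector_field \<Rightarrow> 'm vector_field \<Rightarrow> 'm vector_field"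

definition coordinate_vector ::
    "('m, 'e::euclidean_space) chart set \<Rightarrow> ('m, 'e) chart \<Rightarrow> 'm \<Rightarrow> 'e \<Rightarrow> 'm tangent_vector"
  where "coordinate_vector A = (\<lambda>(U, \<phi>) p e f.
    if f \<in> smooth_functions A
    then frechet_derivative (f \<circ> inv_into U \<phi>) (at (\<phi> p)) e else 0)"

definition tangent_space ::
    "('m, 'e::euclidean_space) chart set \<Rightarrow> 'm \<Rightarrow> 'm tangent_vector set"
  where "tangent_space A p =
    {coordinate_vector A (U, \<phi>) p e | U \<phi> e. (U, \<phi>) \<in> A \<and> p \<in> U}"

definition vector_fields :: "('m, 'e::euclidean_space) chart set \<Rightarrow> 'm vector_field set"
  where "vector_fields A = {X.
    (\<forall>p. X p \<in> tangent_space A p) \<and>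
    (\<forall>f\<in>smooth_functions A. (\<lambda>p. X p f) \<in> smooth_functions A)}"

definition lie_bracket :: "'m vector_field \<Rightarrow> 'm vector_field \<Rightarrow> 'm vector_field"
  where "lie_bracket X Y = (\<lambda>p f. X p (\<lambda>q. Y q f) - Y p (\<lambda>q. X q f))"

definition tensor02_field :: "('m, 'e::euclidean_space) chart set \<Rightarrow> 'm tensor02 \<Rightarrow> bool"
  where "tensor02_field A \<alpha> \<longleftrightarrow>
    (\<forall>p. \<forall>u\<in>tangent_space A p. \<forall>v\<in>tangent_space A p. \<forall>w\<in>tangent_space A p. \<forall>r.
       \<alpha> p (u + v) w = \<alpha> p u w + \<alpha> p v w \<and> \<alpha> p (r *\<^sub>R u) w = r * \<alpha> p u w \<and>
       \<alpha> p w (u + v) = \<alpha> p w u + \<alpha> p w v \<and> \<alpha> p w (r *\<^sub>R u) = r * \<alpha> p w u) \<and>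
    (\<forall>X\<in>vector_fields A. \<forall>Y\<in>vector_fields A. (\<lambda>p. \<alpha> p (X p) (Y p)) \<in> smooth_functions A)"

definition quadratic_form_field :: "('m, 'e::euclidean_space) chart set \<Rightarrow> 'm tensor02 \<Rightarrow> bool"
  where "quadratic_form_field A \<alpha> \<longleftrightarrow> tensor02_field A \<alpha> \<and>
    (\<forall>p. \<forall>u\<in>tangent_space A p. \<forall>v\<in>tangent_space A p. \<alpha> p u v = \<alpha> p v u)"

definition pseudo_riemannian_metric ::
    "('m, 'e::euclidean_space) chart set \<Rightarrow> 'm tensor02 \<Rightarrow> bool"
  where "pseudo_riemannian_metric A g \<longleftrightarrow> quadratic_form_field A g \<and>
    (\<forall>p. \<forall>u\<in>tangent_space A p. (\<forall>v\<in>tangent_space A p. g p u v = 0) \<longrightarrow> u = 0)"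

definition affine_connection :: "('m, 'e::euclidean_space) chart set \<Rightarrow> 'm connection \<Rightarrow> bool"
  where "affine_connection A D \<longleftrightarrow>
    (\<forall>X\<in>vector_fields A. \<forall>Y\<in>vector_fields A. \<forall>Z\<in>vector_fields A. \<forall>f\<in>smooth_functions A.
       D X Y \<in> vector_fields A \<and>
       D (X + Y) Z = D X Z + D Y Z \<and>
       D (\<lambda>p. f p *\<^sub>R X p) Y = (\<lambda>p. f p *\<^sub>R D X Y p) \<and>
       D X (Y + Z) = D X Y + D X Z \<and>
       D X (\<lambda>p. f p *\<^sub>R Y p) = (\<lambda>p. X p f *\<^sub>R Y p + f p *\<^sub>R D X Y p))"

text \<open>\<open>covariant_derivative D \<alpha> X Y Z = (\<nabla>\<^sub>X \<alpha>)(Y, Z)\<close>\<close>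

definition covariant_derivative :: "'m connection \<Rightarrow> 'm tensor02 \<Rightarrow>
    'm vector_field \<Rightarrow> 'm vector_field \<Rightarrow> 'm vector_field \<Rightarrow> 'm \<Rightarrow> real"
  where "covariant_derivative D \<alpha> X Y Z p =
    X p (\<lambda>q. \<alpha> q (Y q) (Z q)) - \<alpha> p (D X Y p) (Z p) - \<alpha> p (Y p) (D X Z p)"

definition parallel ::
    "('m, 'e::euclidean_space) chart set \<Rightarrow> 'm connection \<Rightarrow> 'm tensor02 \<Rightarrow> bool"
  where "parallel A D \<alpha> \<longleftrightarrow>
    (\<forall>X\<in>vector_fields A. \<forall>Y\<in>vector_fields A. \<forall>Z\<in>vector_fields A. \<forall>p.
       covariant_derivative D \<alpha> X Y Z p = 0)"

definition levi_civita_connection ::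
    "('m, 'e::euclidean_space) chart set \<Rightarrow> 'm tensor02 \<Rightarrow> 'm connection \<Rightarrow> bool"
  where "levi_civita_connection A g D \<longleftrightarrow>
    affine_connection A D \<and>
    (\<forall>X\<in>vector_fields A. \<forall>Y\<in>vector_fields A. D X Y - D Y X = lie_bracket X Y) \<and>
    parallel A D g"

definition curvature :: "'m connection \<Rightarrow>
    'm vector_field \<Rightarrow> 'm vector_field \<Rightarrow> 'm vector_field \<Rightarrow> 'm vector_field"
  where "curvature D X Y Z = D X (D Y Z) - D Y (D X Z) - D (lie_bracket X Y) Z"

definition jacobi_operator ::
    "'m connection \<Rightarrow> 'm vector_field \<Rightarrow> 'm vector_field \<Rightarrow> 'm vector_field"
  where "jacobi_operator D \<xi> X = curvature D X \<xi> \<xi>"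

text \<open>The value of \<open>J\<^sub>\<xi> X\<close> at \<open>p\<close> depends only on \<open>X p\<close>, and every tangent vector at \<open>p\<close> is the
  value of some vector field. Hence the set below is the image of the endomorphism that \<open>J\<^sub>\<xi>\<close>
  induces on the tangent space at \<open>p\<close>.\<close>

definition jacobi_rank :: "('m, 'e::euclidean_space) chart set \<Rightarrow> 'm connection \<Rightarrow>
    'm vector_field \<Rightarrow> 'm \<Rightarrow> nat"
  where "jacobi_rank A D \<xi> p = dim ((\<lambda>X. jacobi_operator D \<xi> X p) ` vector_fields A)"

end

theory Submission
  imports Defs
begin

text \<open>
  A parallel form \<open>\<alpha>\<close> is invariant under curvature: commuting two covariant derivatives of
  \<open>\<alpha>(Z, W)\<close> gives \<open>\<alpha>(R\<^bsub>XY\<^esub>Z, W) + \<alpha>(Z, R\<^bsub>XY\<^esub>W) = 0\<close> (\<open>ricci_identity\<close>). With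
  \<open>Y = Z = W = \<xi>\<close> and the symmetry of \<open>\<alpha>\<close> it follows that \<open>\<alpha>(J\<^sub>\<xi> X, \<xi>) = 0\<close>. The metric is
  itself parallel, so the image of \<open>J\<^sub>\<xi>\<close> also lies in the \<open>g\<close>-orthogonal complement of \<open>\<xi>\<close>. As
  \<open>\<xi>\<close> is not isotropic it lies outside that complement, and maximal rank makes \<open>\<xi>\<close> and the image
  of \<open>J\<^sub>\<xi>\<close> together span the tangent space (\<open>jacobi_frame\<close>).

  Put \<open>c = \<alpha>(\<xi>, \<xi>) / g(\<xi>, \<xi>)\<close>. On this frame \<open>\<alpha>(\<xi>, \<cdot>)\<close> and \<open>c g(\<xi>, \<cdot>)\<close> agree, both
  vanishing on the image of \<open>J\<^sub>\<xi>\<close>. The curvature identity with \<open>Y = Z = \<xi>\<close> then transports this to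
  all arguments:
  \<open>\<alpha>(J\<^sub>\<xi> X, W) = - \<alpha>(\<xi>, R\<^bsub>X\<xi>\<^esub>W) = - c g(\<xi>, R\<^bsub>X\<xi>\<^esub>W) = c g(J\<^sub>\<xi> X, W)\<close>
  (\<open>parallel_form_pointwise_proportional\<close>).

  It remains to see that \<open>c\<close> does not vary. Write \<open>c = a / b\<close>. Both forms are parallel, so
  \<open>X a = 2 \<alpha>(\<nabla>\<^sub>X \<xi>, \<xi>) = 2 c g(\<nabla>\<^sub>X \<xi>, \<xi>) = c (X b)\<close>, which says that the derivative of
  \<open>a / b\<close> vanishes. Hence \<open>c\<close> is locally constant, and constant on connected components
  (\<open>quotient_locally_constant\<close>).

  The frame has a second use. The curvature identity and the derivative of \<open>c\<close> are available only
  along globally defined vector fields, whereas the conclusion concerns arbitrary tangent vectors.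
  The members of the frame are values of the global fields \<open>\<xi>\<close> and \<open>J\<^sub>\<xi> X\<close>, so linearity in the
  tangent vector settles the general case without extending single vectors by cut-off functions.
\<close>

section \<open>Smooth functions\<close>

lemma C_k_on_cong:
  assumes "open S" "\<And>x. x \<in> S \<Longrightarrow> f x = h x" "C_k_on k S f"
  shows "C_k_on k S h"
  using assms(2,3)
proof (induction k arbitrary: f h)
  case 0
  then show ?case by (simp cong: continuous_on_cong)
next
  case (Suc k)
  have diff: "f differentiable (at x)" if "x \<in> S" for x
    using Suc.prems(2) that by simp
  have hd: "(h has_derivative frechet_derivative f (at x)) (at x)" if "x \<in> S" for x
    using diff[OF that] assms(1) that Suc.prems(1)
    by (meson frechet_derivative_works has_derivative_transform_within_open)
  have eq: "frechet_derivative f (at x) = frechet_derivative h (at x)" if "x \<in> S" for x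
    using hd[OF that] frechet_derivative_at by blast
  show ?case
  proof (simp, intro conjI ballI allI)
    show "h differentiable (at x)" if "x \<in> S" for x
      using hd[OF that] by (auto simp: differentiable_def)
    show "C_k_on k S (\<lambda>x. frechet_derivative h (at x) v)" for v
      by (rule Suc.IH[of "\<lambda>x. frechet_derivative f (at x) v"]) (use Suc.prems(2) eq in simp_all)
  qed
qed

lemma C_k_on_zero: "C_k_on k S (\<lambda>x. 0)"
  by (induction k) (simp_all add: frechet_derivative_const)

lemma frechet_derivative_add:
  assumes "f differentiable (at x)" "h differentiable (at x)"
  shows "frechet_derivative (\<lambda>x. f x + h x) (at x) v =
    frechet_derivative f (at x) v + frechet_derivative h (at x) v"
  using has_derivative_add[OF assms[unfolded frechet_derivative_works]] frechet_derivative_at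
  by metis

lemma C_k_on_add:
  assumes "open S" "C_k_on k S f" "C_k_on k S h"
  shows "C_k_on k S (\<lambda>x. f x + h x)"
  using assms(2,3)
proof (induction k arbitrary: f h)
  case 0
  then show ?case by (simp add: continuous_on_add)
next
  case (Suc k)
  show ?case
  proof (simp, intro conjI ballI allI)
    show "(\<lambda>x. f x + h x) differentiable (at x)" if "x \<in> S" for x
      using Suc.prems that by auto
    fix v
    have "C_k_on k S (\<lambda>x. frechet_derivative f (at x) v + frechet_derivative h (at x) v)"
      using Suc by simp
    then show "C_k_on k S (\<lambda>x. frechet_derivative (\<lambda>x. f x + h x) (at x) v)"
      by (rule C_k_on_cong[OF assms(1), rotated])
        (use Suc.prems in \<open>simp add: frechet_derivative_add\<close>)
  qed
qed

lemma C_k_on_minus: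
  assumes "open S" "C_k_on k S f"
  shows "C_k_on k S (\<lambda>x. - f x)"
  using assms(2)
proof (induction k arbitrary: f)
  case 0
  then show ?case by (simp add: continuous_on_minus)
next
  case (Suc k)
  show ?case
  proof (simp, intro conjI ballI allI)
    show "(\<lambda>x. - f x) differentiable (at x)" if "x \<in> S" for x
      using Suc.prems that by auto
    fix v
    have "C_k_on k S (\<lambda>x. - frechet_derivative f (at x) v)"
      using Suc by simp
    moreover have "- frechet_derivative f (at x) v = frechet_derivative (\<lambda>x. - f x) (at x) v"
      if "x \<in> S" for x
    proof -
      have "(f has_derivative frechet_derivative f (at x)) (at x)"
        using Suc.prems that frechet_derivative_works by auto
      from has_derivative_minus[OF this] show ?thesis
        using frechet_derivative_at by metis
    qed
    ultimately show "C_k_on k S (\<lambda>x. frechet_derivative (\<lambda>x. - f x) (at x) v)"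
      by (rule C_k_on_cong[OF assms(1), rotated]) simp_all
  qed
qed

lemma smooth_on_differentiable:
  "smooth_on S f \<Longrightarrow> x \<in> S \<Longrightarrow> f differentiable (at x)"
  unfolding smooth_on_def by (metis C_k_on.simps(2))

lemma smooth_atlas_chartD:
  assumes "smooth_atlas A" "(U, \<phi>) \<in> A"
  shows "open U" "open (\<phi> ` U)" "homeomorphism U (\<phi> ` U) \<phi> (inv_into U \<phi>)"
  using assms unfolding smooth_atlas_def is_chart_def by auto

lemma smooth_atlas_chart_at:
  assumes "smooth_atlas A"
  obtains U \<phi> where "(U, \<phi>) \<in> A" "p \<in> U"
proof -
  have "p \<in> (\<Union>C\<in>A. fst C)" using assms unfolding smooth_atlas_def by simp
  then obtain C where "C \<in> A" "p \<in> fst C" by blast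
  then show thesis using that[of "fst C" "snd C"] by simp
qed

lemma chart_inv:
  assumes "smooth_atlas A" "(U, \<phi>) \<in> A" "p \<in> U"
  shows "inv_into U \<phi> (\<phi> p) = p"
  using smooth_atlas_chartD(3)[OF assms(1,2)] assms(3) homeomorphism_apply1 by metis

lemma smooth_functions_add:
  assumes "smooth_atlas A" "f \<in> smooth_functions A" "h \<in> smooth_functions A"
  shows "(\<lambda>p. f p + h p) \<in> smooth_functions A"
  using assms smooth_atlas_chartD(2)[OF assms(1)]
  by (fastforce simp: smooth_functions_def smooth_on_def o_def intro!: C_k_on_add)

lemma smooth_functions_zero: "(\<lambda>p. 0) \<in> smooth_functions A"
  by (auto simp: smooth_functions_def smooth_on_def o_def C_k_on_zero)

lemma smooth_functions_minus:
  assumes "smooth_atlas A" "f \<in> smooth_functions A"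
  shows "(\<lambda>p. - f p) \<in> smooth_functions A"
  using assms smooth_atlas_chartD(2)[OF assms(1)]
  by (fastforce simp: smooth_functions_def smooth_on_def o_def intro!: C_k_on_minus)

lemma smooth_function_differentiable:
  assumes "f \<in> smooth_functions A" "(U, \<phi>) \<in> A" "p \<in> U"
  shows "(f \<circ> inv_into U \<phi>) differentiable (at (\<phi> p))"
  using assms smooth_on_differentiable unfolding smooth_functions_def by fastforce

section \<open>Tangent spaces\<close>

lemma linear_coordinate_vector:
  assumes "(U, \<phi>) \<in> A" "p \<in> U"
  shows "linear (coordinate_vector A (U, \<phi>) p)"
proof (rule linearI; rule ext)
  fix e e' :: 'b and r :: real and f :: "'a \<Rightarrow> real"
  have lin: "linear (frechet_derivative (f \<circ> inv_into U \<phi>) (at (\<phi> p)))"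
    if "f \<in> smooth_functions A"
    by (rule linear_frechet_derivative[OF smooth_function_differentiable[OF that assms]])
  show "coordinate_vector A (U, \<phi>) p (e + e') f =
      (coordinate_vector A (U, \<phi>) p e + coordinate_vector A (U, \<phi>) p e') f"
    using linear_add[OF lin] by (simp add: coordinate_vector_def)
  show "coordinate_vector A (U, \<phi>) p (r *\<^sub>R e) f = (r *\<^sub>R coordinate_vector A (U, \<phi>) p e) f"
    using linear_scale[OF lin] by (simp add: coordinate_vector_def scaleR_fun_def)
qed

text \<open>
  The chain rule for the transition map \<open>\<tau> = \<phi> \<circ> \<psi>\<^sup>-\<^sup>1\<close>: a coordinate vector of one chart is one of
  every other chart around \<open>p\<close>. This makes the union over charts that defines the tangent space the
  image of a single linear map, and hence a subspace of dimension at most that of the model space.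
\<close>

lemma coordinate_vector_change_chart:
  fixes A :: "('m::{t2_space,second_countable_topology}, 'e::euclidean_space) chart set"
  assumes A: "smooth_atlas A" and U: "(U, \<phi>) \<in> A" "p \<in> U" and V: "(V, \<psi>) \<in> A" "p \<in> V"
  shows "coordinate_vector A (V, \<psi>) p e =
    coordinate_vector A (U, \<phi>) p (frechet_derivative (\<phi> \<circ> inv_into V \<psi>) (at (\<psi> p)) e)"
proof
  fix f :: "'m \<Rightarrow> real"
  let ?\<tau> = "\<phi> \<circ> inv_into V \<psi>"
  let ?W = "\<psi> ` (U \<inter> V)"
  have "openin (top_of_set V) (V \<inter> U)"
    using smooth_atlas_chartD(1)[OF A U(1)] by (rule openin_open_Int)
  then have "openin (top_of_set (\<psi> ` V)) (\<psi> ` (V \<inter> U))"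
    by (rule homeomorphism_imp_open_map[OF smooth_atlas_chartD(3)[OF A V(1)]])
  then have W: "open ?W"
    using smooth_atlas_chartD(2)[OF A V(1)] by (simp add: openin_open_eq Int_commute)
  have p: "\<psi> p \<in> ?W" using U V by auto
  have "smooth_on (\<psi> ` (V \<inter> U)) ?\<tau>"
    using A U(1) V(1) unfolding smooth_atlas_def by fastforce
  then have \<tau>: "(?\<tau> has_derivative frechet_derivative ?\<tau> (at (\<psi> p))) (at (\<psi> p))"
    using smooth_on_differentiable p frechet_derivative_works by (metis Int_commute)
  have \<tau>p: "?\<tau> (\<psi> p) = \<phi> p" using chart_inv[OF A V] by simp
  show "coordinate_vector A (V, \<psi>) p e f =
    coordinate_vector A (U, \<phi>) p (frechet_derivative ?\<tau> (at (\<psi> p)) e) f"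
  proof (cases "f \<in> smooth_functions A")
    case True
    let ?f = "f \<circ> inv_into U \<phi>"
    have "(?f has_derivative frechet_derivative ?f (at (\<phi> p))) (at (?\<tau> (\<psi> p)))"
      using smooth_function_differentiable[OF True U] frechet_derivative_works \<tau>p by metis
    from diff_chain_at[OF \<tau> this]
    have "((?f \<circ> ?\<tau>) has_derivative
        frechet_derivative ?f (at (\<phi> p)) \<circ> frechet_derivative ?\<tau> (at (\<psi> p))) (at (\<psi> p))" .
    moreover have "(?f \<circ> ?\<tau>) y = (f \<circ> inv_into V \<psi>) y" if "y \<in> ?W" for y
      using that chart_inv[OF A U(1)] chart_inv[OF A V(1)] by auto
    ultimately have "((f \<circ> inv_into V \<psi>) has_derivative
        frechet_derivative ?f (at (\<phi> p)) \<circ> frechet_derivative ?\<tau> (at (\<psi> p))) (at (\<psi> p))"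
      using has_derivative_transform_within_open[OF _ W p] by blast
    then have "frechet_derivative (f \<circ> inv_into V \<psi>) (at (\<psi> p)) =
        frechet_derivative ?f (at (\<phi> p)) \<circ> frechet_derivative ?\<tau> (at (\<psi> p))"
      using frechet_derivative_at by metis
    then show ?thesis using True by (simp add: coordinate_vector_def)
  qed (simp add: coordinate_vector_def)
qed

lemma tangent_space_eq_range:
  assumes "smooth_atlas A" "(U, \<phi>) \<in> A" "p \<in> U"
  shows "tangent_space A p = range (coordinate_vector A (U, \<phi>) p)"
  using assms coordinate_vector_change_chart[OF assms]
  unfolding tangent_space_def by blast

lemma subspace_tangent_space:
  assumes "smooth_atlas A"
  shows "subspace (tangent_space A p)"
proof -
  obtain U \<phi> where U: "(U, \<phi>) \<in> A" "p \<in> U" using smooth_atlas_chart_at[OF assms] .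
  show ?thesis
    unfolding tangent_space_eq_range[OF assms U]
    by (rule linear_subspace_image[OF linear_coordinate_vector[OF U] subspace_UNIV])
qed

lemma tangent_space_finite_span:
  fixes A :: "('m::{t2_space,second_countable_topology}, 'e::euclidean_space) chart set"
  assumes "smooth_atlas A"
  obtains G where "finite G" "card G \<le> DIM('e)" "span G = tangent_space A p"
proof -
  obtain U \<phi> where U: "(U, \<phi>) \<in> A" "p \<in> U" using smooth_atlas_chart_at[OF assms] .
  let ?G = "coordinate_vector A (U, \<phi>) p ` Basis"
  have "span ?G = tangent_space A p"
    using linear_span_image[OF linear_coordinate_vector[OF U], of Basis]
    by (simp add: tangent_space_eq_range[OF assms U] span_Basis)
  then show ?thesis
    using that[of ?G] by (simp add: card_image_le)
qed

lemma tangent_vector_add: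
  assumes "smooth_atlas A" "v \<in> tangent_space A p" "f \<in> smooth_functions A"
    "h \<in> smooth_functions A"
  shows "v (\<lambda>q. f q + h q) = v f + v h"
proof -
  obtain U \<phi> e where U: "(U, \<phi>) \<in> A" "p \<in> U" and v: "v = coordinate_vector A (U, \<phi>) p e"
    using assms(2) unfolding tangent_space_def by blast
  have "(\<lambda>q. f q + h q) \<circ> inv_into U \<phi> = (\<lambda>y. (f \<circ> inv_into U \<phi>) y + (h \<circ> inv_into U \<phi>) y)"
    by (simp add: fun_eq_iff)
  then show ?thesis
    using assms(3,4) smooth_functions_add[OF assms(1,3,4)]
      smooth_function_differentiable[OF assms(3) U] smooth_function_differentiable[OF assms(4) U]
    by (simp add: v coordinate_vector_def frechet_derivative_add del: o_apply)
qed

section \<open>Vector fields and tensor fields\<close>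

lemma vector_field_tangent: "X \<in> vector_fields A \<Longrightarrow> X p \<in> tangent_space A p"
  unfolding vector_fields_def by auto

lemma vector_fields_diff:
  assumes A: "smooth_atlas A" and X: "X \<in> vector_fields A" and Y: "Y \<in> vector_fields A"
  shows "X - Y \<in> vector_fields A"
proof -
  have "(X - Y) p \<in> tangent_space A p" for p
    using subspace_diff[OF subspace_tangent_space[OF A]
        vector_field_tangent[OF X] vector_field_tangent[OF Y]] by simp
  moreover have "(\<lambda>p. (X - Y) p f) \<in> smooth_functions A" if "f \<in> smooth_functions A" for f
  proof -
    have "(\<lambda>p. X p f) \<in> smooth_functions A" "(\<lambda>p. Y p f) \<in> smooth_functions A"
      using that X Y unfolding vector_fields_def by auto
    from smooth_functions_add[OF A this(1) smooth_functions_minus[OF A this(2)]]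
    show ?thesis by simp
  qed
  ultimately show ?thesis unfolding vector_fields_def by simp
qed

lemma tensor02_add_left:
  assumes "tensor02_field A \<alpha>" "u \<in> tangent_space A p" "v \<in> tangent_space A p"
    "w \<in> tangent_space A p"
  shows "\<alpha> p (u + v) w = \<alpha> p u w + \<alpha> p v w"
  using assms unfolding tensor02_field_def by blast

lemma tensor02_scale_left:
  assumes "tensor02_field A \<alpha>" "u \<in> tangent_space A p" "w \<in> tangent_space A p"
  shows "\<alpha> p (r *\<^sub>R u) w = r * \<alpha> p u w"
  using assms unfolding tensor02_field_def by blast

lemma tensor02_diff_left:
  assumes "smooth_atlas A" "tensor02_field A \<alpha>" "u \<in> tangent_space A p" "v \<in> tangent_space A p"
    "w \<in> tangent_space A p"
  shows "\<alpha> p (u - v) w = \<alpha> p u w - \<alpha> p v w"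
  using tensor02_add_left[OF assms(2) subspace_diff[OF subspace_tangent_space[OF assms(1)]
      assms(3,4)] assms(4,5)] by simp

lemma quadratic_form_tensor: "quadratic_form_field A \<alpha> \<Longrightarrow> tensor02_field A \<alpha>"
  and quadratic_form_sym: "quadratic_form_field A \<alpha> \<Longrightarrow> u \<in> tangent_space A p \<Longrightarrow>
    v \<in> tangent_space A p \<Longrightarrow> \<alpha> p u v = \<alpha> p v u"
  unfolding quadratic_form_field_def by blast+

lemma tensor02_smooth:
  assumes "tensor02_field A \<alpha>" "X \<in> vector_fields A" "Y \<in> vector_fields A"
  shows "(\<lambda>p. \<alpha> p (X p) (Y p)) \<in> smooth_functions A"
  using assms unfolding tensor02_field_def by blast

text \<open>
  A tensor field is bilinear only on tangent vectors, so the set of vectors on which the two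
  functionals agree is formed inside the tangent space.
\<close>

lemma tensor02_proportional_on_span:
  assumes A: "smooth_atlas A" and \<alpha>: "tensor02_field A \<alpha>" and \<beta>: "tensor02_field A \<beta>"
    and S: "span S = tangent_space A p"
    and eq: "\<And>s. s \<in> S \<Longrightarrow> \<alpha> p s w = c * \<beta> p s w"
    and u: "u \<in> tangent_space A p" and w: "w \<in> tangent_space A p"
  shows "\<alpha> p u w = c * \<beta> p u w"
proof -
  let ?E = "{v \<in> tangent_space A p. \<alpha> p v w = c * \<beta> p v w}"
  have sub: "subspace (tangent_space A p)" by (rule subspace_tangent_space[OF A])
  have "\<alpha> p 0 w = 0" "\<beta> p 0 w = 0"
    using tensor02_scale_left[OF \<alpha> u w, of 0] tensor02_scale_left[OF \<beta> u w, of 0] by auto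
  then have "subspace ?E"
    using sub tensor02_add_left[OF \<alpha> _ _ w] tensor02_add_left[OF \<beta> _ _ w]
      tensor02_scale_left[OF \<alpha> _ w] tensor02_scale_left[OF \<beta> _ w]
    by (auto simp: subspace_def algebra_simps)
  moreover have "S \<subseteq> ?E" using eq S span_superset by fastforce
  ultimately have "span S \<subseteq> ?E" by (rule span_minimal[rotated])
  then show ?thesis using S u by auto
qed

section \<open>Curvature and parallel tensors\<close>

text \<open>
  The connection axioms are stated under one common quantifier that includes a smooth function; the
  zero function instantiates it.
\<close>

lemma connection_vector_field:
  assumes "affine_connection A D" "X \<in> vector_fields A" "Y \<in> vector_fields A"
  shows "D X Y \<in> vector_fields A"
  using assms smooth_functions_zero[of A] unfolding affine_connection_def by meson

text \<open>
  Torsion-freeness, \<open>[X, Y] = \<nabla>\<^sub>X Y - \<nabla>\<^sub>Y X\<close>, replaces the computation of the bracket in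
  coordinates.
\<close>

lemma lie_bracket_vector_field:
  assumes "smooth_atlas A" "levi_civita_connection A g D" "X \<in> vector_fields A"
    "Y \<in> vector_fields A"
  shows "lie_bracket X Y \<in> vector_fields A"
proof -
  have "affine_connection A D" and "D X Y - D Y X = lie_bracket X Y"
    using assms unfolding levi_civita_connection_def by auto
  then show ?thesis
    using vector_fields_diff[OF assms(1)] connection_vector_field assms(3,4) by metis
qed

lemma curvature_vector_field:
  assumes "smooth_atlas A" "levi_civita_connection A g D" "X \<in> vector_fields A"
    "Y \<in> vector_fields A" "Z \<in> vector_fields A"
  shows "curvature D X Y Z \<in> vector_fields A"
proof -
  have "affine_connection A D" using assms(2) unfolding levi_civita_connection_def by simp
  note cl = connection_vector_field[OF this]
  show ?thesis
    unfolding curvature_def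
    by (intro vector_fields_diff[OF assms(1)] cl assms lie_bracket_vector_field[OF assms(1-4)])
qed

lemma parallel_derivative:
  assumes "parallel A D \<alpha>" "X \<in> vector_fields A" "Y \<in> vector_fields A" "Z \<in> vector_fields A"
  shows "X p (\<lambda>q. \<alpha> q (Y q) (Z q)) = \<alpha> p (D X Y p) (Z p) + \<alpha> p (Y p) (D X Z p)"
  using assms unfolding parallel_def covariant_derivative_def by (auto simp: algebra_simps)

text \<open>
  The two mixed terms are together symmetric in \<open>X\<close> and \<open>Y\<close>; they cancel in the commutator, which
  is how the curvature alone survives in the identity below.
\<close>

lemma parallel_second_derivative:
  assumes A: "smooth_atlas A" and D: "affine_connection A D"
    and \<alpha>: "tensor02_field A \<alpha>" and par: "parallel A D \<alpha>"
    and X: "X \<in> vector_fields A" and Y: "Y \<in> vector_fields A"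
    and Z: "Z \<in> vector_fields A" and W: "W \<in> vector_fields A"
  shows "X p (\<lambda>q. Y q (\<lambda>r. \<alpha> r (Z r) (W r))) =
    \<alpha> p (D X (D Y Z) p) (W p) + \<alpha> p (D Y Z p) (D X W p) +
    (\<alpha> p (D X Z p) (D Y W p) + \<alpha> p (Z p) (D X (D Y W) p))"
proof -
  note cl = connection_vector_field[OF D]
  have "X p (\<lambda>q. Y q (\<lambda>r. \<alpha> r (Z r) (W r))) =
      X p (\<lambda>q. \<alpha> q (D Y Z q) (W q) + \<alpha> q (Z q) (D Y W q))"
    by (simp add: parallel_derivative[OF par Y Z W])
  also have "\<dots> = X p (\<lambda>q. \<alpha> q (D Y Z q) (W q)) + X p (\<lambda>q. \<alpha> q (Z q) (D Y W q))"
    by (intro tangent_vector_add[OF A vector_field_tangent[OF X]] tensor02_smooth[OF \<alpha>] cl Y Z W)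
  finally show ?thesis
    by (simp add: parallel_derivative[OF par X] cl Y Z W)
qed

lemma ricci_identity:
  assumes A: "smooth_atlas A" and D: "levi_civita_connection A g D"
    and \<alpha>: "quadratic_form_field A \<alpha>" and par: "parallel A D \<alpha>"
    and X: "X \<in> vector_fields A" and Y: "Y \<in> vector_fields A"
    and Z: "Z \<in> vector_fields A" and W: "W \<in> vector_fields A"
  shows "\<alpha> p (curvature D X Y Z p) (W p) + \<alpha> p (Z p) (curvature D X Y W p) = 0"
proof -
  have aff: "affine_connection A D" using D unfolding levi_civita_connection_def by simp
  note cl = connection_vector_field[OF aff]
  note L = lie_bracket_vector_field[OF A D X Y]
  note \<alpha>' = quadratic_form_tensor[OF \<alpha>]
  have split: "\<alpha> p (curvature D X Y Z p) (W p) = \<alpha> p (D X (D Y Z) p) (W p)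
      - \<alpha> p (D Y (D X Z) p) (W p) - \<alpha> p (D (lie_bracket X Y) Z p) (W p)"
    if Z: "Z \<in> vector_fields A" and W: "W \<in> vector_fields A" for Z W
    using vector_field_tangent[OF cl[OF X cl[OF Y Z]], of p]
      vector_field_tangent[OF cl[OF Y cl[OF X Z]], of p] vector_field_tangent[OF cl[OF L Z], of p]
      vector_field_tangent[OF W, of p]
    by (simp add: curvature_def tensor02_diff_left[OF A \<alpha>']
        subspace_diff[OF subspace_tangent_space[OF A]])
  have "\<alpha> p (Z p) (V p) = \<alpha> p (V p) (Z p)" if "V \<in> vector_fields A" for V
    by (rule quadratic_form_sym[OF \<alpha> vector_field_tangent[OF Z] vector_field_tangent[OF that]])
  note sym = this[OF curvature_vector_field[OF A D X Y W]] this[OF cl[OF X cl[OF Y W]]]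
    this[OF cl[OF Y cl[OF X W]]] this[OF cl[OF L W]]
  have "lie_bracket X Y p (\<lambda>r. \<alpha> r (Z r) (W r)) =
      X p (\<lambda>q. Y q (\<lambda>r. \<alpha> r (Z r) (W r))) - Y p (\<lambda>q. X q (\<lambda>r. \<alpha> r (Z r) (W r)))"
    by (simp add: lie_bracket_def)
  then show ?thesis
    unfolding parallel_second_derivative[OF A aff \<alpha>' par X Y Z W]
      parallel_second_derivative[OF A aff \<alpha>' par Y X Z W] parallel_derivative[OF par L Z W]
      sym split[OF Z W] split[OF W Z]
    by simp
qed

text \<open>
  For \<open>Y = Z = W = \<xi>\<close> both terms of the curvature identity are \<open>\<alpha>(J\<^sub>\<xi> X, \<xi>)\<close>. It is applied to the
  given form and to the metric.
\<close>

lemma jacobi_orthogonal: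
  assumes "smooth_atlas A" "levi_civita_connection A g D"
    "quadratic_form_field A \<alpha>" "parallel A D \<alpha>" "X \<in> vector_fields A" "\<xi> \<in> vector_fields A"
  shows "\<alpha> p (jacobi_operator D \<xi> X p) (\<xi> p) = 0"
proof -
  have "\<alpha> p (\<xi> p) (curvature D X \<xi> \<xi> p) = \<alpha> p (curvature D X \<xi> \<xi> p) (\<xi> p)"
    by (rule quadratic_form_sym[OF assms(3) vector_field_tangent[OF assms(6)]
          vector_field_tangent[OF curvature_vector_field[OF assms(1,2,5,6,6)]]])
  then show ?thesis
    using ricci_identity[OF assms(1-5,6,6,6), of p] by (simp add: jacobi_operator_def)
qed

section \<open>The frame given by maximal rank\<close>

text \<open>
  The ambient space of functionals has infinite dimension, so the count is made against the finite
  generating set \<open>G\<close>: a basis of \<open>S\<close> together with \<open>x\<close> has at least \<open>card G\<close> independent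
  elements, and another vector of \<open>span G\<close> independent of them would make one too many.
\<close>

lemma span_insert_eq_of_dim:
  fixes S :: "'v::real_vector set"
  assumes G: "finite G" "card G \<le> dim S + 1" and S: "S \<subseteq> span G"
    and x: "x \<in> span G" "x \<notin> span S"
  shows "span (insert x S) = span G"
proof (rule antisym)
  show "span (insert x S) \<subseteq> span G"
    using S x(1) by (intro span_minimal) auto
  obtain B where B: "B \<subseteq> S" "independent B" "S \<subseteq> span B" "card B = dim S"
    using basis_exists by blast
  have "span B = span S" using B by (intro span_eq[THEN iffD2]) (auto intro: span_base)
  then have xB: "independent (insert x B)" "x \<notin> B"
    using x(2) B(2) by (auto simp: independent_insert span_base)
  have fB: "finite B" using independent_span_bound[OF G(1) B(2)] B(1) S by blast
  have "v \<in> span (insert x B)" if "v \<in> span G" for v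
  proof (rule ccontr)
    assume v: "v \<notin> span (insert x B)"
    then have "v \<notin> insert x B" using span_base by blast
    with v xB(1) have "independent (insert v (insert x B))" by (simp add: independent_insert)
    moreover have "insert v (insert x B) \<subseteq> span G" using that x(1) B(1) S by auto
    ultimately have "card (insert v (insert x B)) \<le> card G"
      using independent_span_bound[OF G(1)] by blast
    then show False using \<open>v \<notin> insert x B\<close> xB(2) fB B(4) G(2) by simp
  qed
  moreover have "span (insert x B) \<subseteq> span (insert x S)"
    using B(1) by (intro span_mono) auto
  ultimately show "span G \<subseteq> span (insert x S)" by blast
qed

text \<open>
  The span of the image of \<open>J\<^sub>\<xi>\<close> consists of vectors orthogonal to \<open>\<xi>\<close>, so it misses the
  non-isotropic \<open>\<xi>\<close>. Adding \<open>\<xi>\<close> therefore raises the dimension by one, to that of the model space.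
\<close>

lemma jacobi_frame:
  fixes A :: "('m::{t2_space,second_countable_topology}, 'e::euclidean_space) chart set"
  assumes A: "smooth_atlas A" and n: "DIM('e) \<le> jacobi_rank A D \<xi> p + 1"
    and g: "quadratic_form_field A g" and D: "levi_civita_connection A g D"
    and \<xi>: "\<xi> \<in> vector_fields A" and ne: "g p (\<xi> p) (\<xi> p) \<noteq> 0"
  shows "span (insert (\<xi> p) ((\<lambda>X. jacobi_operator D \<xi> X p) ` vector_fields A))
    = tangent_space A p"
proof -
  let ?J = "(\<lambda>X. jacobi_operator D \<xi> X p) ` vector_fields A"
  note sub = subspace_tangent_space[OF A, of p]
  note g' = quadratic_form_tensor[OF g]
  note \<xi>p = vector_field_tangent[OF \<xi>, of p]
  have par: "parallel A D g" using D unfolding levi_civita_connection_def by simp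
  obtain G where G: "finite G" "card G \<le> DIM('e)" "span G = tangent_space A p"
    using tangent_space_finite_span[OF A] .
  have J: "?J \<subseteq> tangent_space A p"
    using vector_field_tangent[OF curvature_vector_field[OF A D _ \<xi> \<xi>]]
    by (auto simp: jacobi_operator_def)
  have "g p 0 (\<xi> p) = 0" using tensor02_scale_left[OF g' \<xi>p \<xi>p, of 0] by simp
  then have "subspace {v \<in> tangent_space A p. g p v (\<xi> p) = 0}"
    using sub tensor02_add_left[OF g' _ _ \<xi>p] tensor02_scale_left[OF g' _ \<xi>p]
    by (auto simp: subspace_def)
  moreover have "?J \<subseteq> {v \<in> tangent_space A p. g p v (\<xi> p) = 0}"
    using J jacobi_orthogonal[OF A D g par _ \<xi>] by auto
  ultimately have "span ?J \<subseteq> {v \<in> tangent_space A p. g p v (\<xi> p) = 0}"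
    by (rule span_minimal[rotated])
  then have "\<xi> p \<notin> span ?J" using ne by auto
  moreover have "card G \<le> dim ?J + 1" using G(2) n unfolding jacobi_rank_def by simp
  ultimately show ?thesis
    using span_insert_eq_of_dim[of G ?J "\<xi> p"] G J \<xi>p by simp
qed

section \<open>Proportionality\<close>

lemma parallel_form_pointwise_proportional:
  assumes A: "smooth_atlas A"
    and g: "quadratic_form_field A g" and D: "levi_civita_connection A g D"
    and \<xi>: "\<xi> \<in> vector_fields A" and ne: "g p (\<xi> p) (\<xi> p) \<noteq> 0"
    and frame: "span (insert (\<xi> p) ((\<lambda>X. jacobi_operator D \<xi> X p) ` vector_fields A))
      = tangent_space A p"
    and \<alpha>: "quadratic_form_field A \<alpha>" and par: "parallel A D \<alpha>"
    and u: "u \<in> tangent_space A p" and v: "v \<in> tangent_space A p"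
  shows "\<alpha> p u v = \<alpha> p (\<xi> p) (\<xi> p) / g p (\<xi> p) (\<xi> p) * g p u v"
proof -
  define c where "c = \<alpha> p (\<xi> p) (\<xi> p) / g p (\<xi> p) (\<xi> p)"
  have parg: "parallel A D g" using D unfolding levi_civita_connection_def by simp
  note \<xi>p = vector_field_tangent[OF \<xi>, of p]
  note extend = tensor02_proportional_on_span[OF A quadratic_form_tensor[OF \<alpha>]
      quadratic_form_tensor[OF g] frame]
  note sym = quadratic_form_sym[OF \<alpha>, of _ p] quadratic_form_sym[OF g, of _ p]
  \<comment> \<open>On \<open>\<xi>\<close> the two sides agree by the choice of \<open>c\<close>; on the image of \<open>J\<^sub>\<xi>\<close> both vanish.\<close>
  have \<xi>1: "\<alpha> p w (\<xi> p) = c * g p w (\<xi> p)" if "w \<in> tangent_space A p" for w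
  proof (rule extend[OF _ that \<xi>p])
    show "\<alpha> p s (\<xi> p) = c * g p s (\<xi> p)"
      if "s \<in> insert (\<xi> p) ((\<lambda>X. jacobi_operator D \<xi> X p) ` vector_fields A)" for s
      using that ne jacobi_orthogonal[OF A D \<alpha> par _ \<xi>] jacobi_orthogonal[OF A D g parg _ \<xi>]
      by (auto simp: c_def)
  qed
  have \<xi>2: "\<alpha> p (\<xi> p) w = c * g p (\<xi> p) w" if "w \<in> tangent_space A p" for w
    using \<xi>1[OF that] sym[OF \<xi>p that] by simp
  have J: "\<alpha> p (jacobi_operator D \<xi> X p) (W p) = c * g p (jacobi_operator D \<xi> X p) (W p)"
    if X: "X \<in> vector_fields A" and W: "W \<in> vector_fields A" for X W
  proof -
    have "\<alpha> p (jacobi_operator D \<xi> X p) (W p) = - \<alpha> p (\<xi> p) (curvature D X \<xi> W p)"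
      and "g p (jacobi_operator D \<xi> X p) (W p) = - g p (\<xi> p) (curvature D X \<xi> W p)"
      using ricci_identity[OF A D \<alpha> par X \<xi> \<xi> W, of p]
        ricci_identity[OF A D g parg X \<xi> \<xi> W, of p]
      by (simp_all add: jacobi_operator_def)
    moreover have "\<alpha> p (\<xi> p) (curvature D X \<xi> W p) = c * g p (\<xi> p) (curvature D X \<xi> W p)"
      by (rule \<xi>2[OF vector_field_tangent[OF curvature_vector_field[OF A D X \<xi> W]]])
    ultimately show ?thesis by (simp only: mult_minus_right)
  qed
  \<comment> \<open>The second slot is still the value of a global field, because the curvature identity needs
    one; the frame and symmetry remove this restriction afterwards.\<close>
  have field: "\<alpha> p w (W p) = c * g p w (W p)"
    if W: "W \<in> vector_fields A" and w: "w \<in> tangent_space A p" for W w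
    by (rule extend[OF _ w vector_field_tangent[OF W]])
      (use J[OF _ W] \<xi>2[OF vector_field_tangent[OF W]] in auto)
  have Jf: "jacobi_operator D \<xi> X \<in> vector_fields A" if "X \<in> vector_fields A" for X
    using curvature_vector_field[OF A D that \<xi> \<xi>] unfolding jacobi_operator_def .
  have "\<alpha> p s v = c * g p s v"
    if s: "s \<in> insert (\<xi> p) ((\<lambda>X. jacobi_operator D \<xi> X p) ` vector_fields A)" for s
  proof -
    obtain W where W: "W \<in> vector_fields A" "s = W p" using s \<xi> Jf by blast
    show ?thesis
      using field[OF W(1) v] sym[OF v vector_field_tangent[OF W(1)]] W(2) by simp
  qed
  then have "\<alpha> p u v = c * g p u v" by (rule extend[OF _ u v])
  then show ?thesis unfolding c_def .
qed

text \<open>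
  The hypothesis on \<open>v a\<close> is \<open>da = (a / b) db\<close>, the vanishing of the numerator in the quotient rule
  for \<open>d(a / b)\<close>. Working with the quotient rule in a chart, where differentiability is enough,
  avoids showing that \<open>a / b\<close> is a smooth function.
\<close>

lemma quotient_locally_constant:
  fixes A :: "('m::{t2_space,second_countable_topology}, 'e::euclidean_space) chart set"
  assumes A: "smooth_atlas A" and a: "a \<in> smooth_functions A" and b: "b \<in> smooth_functions A"
    and b0: "\<And>p. b p \<noteq> 0"
    and eq: "\<And>p v. v \<in> tangent_space A p \<Longrightarrow> v a = a p / b p * v b"
  obtains T where "open T" "p \<in> T" "\<And>q. q \<in> T \<Longrightarrow> a q / b q = a p / b p"
proof -
  obtain U \<phi> where U: "(U, \<phi>) \<in> A" "p \<in> U" using smooth_atlas_chart_at[OF A] .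
  note ch = smooth_atlas_chartD[OF A U(1)]
  let ?a = "a \<circ> inv_into U \<phi>" and ?b = "b \<circ> inv_into U \<phi>"
  obtain r where r: "r > 0" "ball (\<phi> p) r \<subseteq> \<phi> ` U"
    using ch(2) U(2) open_contains_ball by blast
  have der: "((\<lambda>y. ?a y / ?b y) has_derivative (\<lambda>h. 0)) (at y within ball (\<phi> p) r)"
    if y: "y \<in> ball (\<phi> p) r" for y
  proof -
    obtain q where q: "q \<in> U" "y = \<phi> q" using y r by auto
    have iq: "inv_into U \<phi> y = q" using chart_inv[OF A U(1) q(1)] q(2) by simp
    have da: "(?a has_derivative frechet_derivative ?a (at y)) (at y)"
      and db: "(?b has_derivative frechet_derivative ?b (at y)) (at y)"
      using smooth_function_differentiable[OF a U(1) q(1)]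
        smooth_function_differentiable[OF b U(1) q(1)] frechet_derivative_works q(2) by auto
    have "frechet_derivative ?a (at y) h = a q / b q * frechet_derivative ?b (at y) h" for h
    proof -
      have "coordinate_vector A (U, \<phi>) q h \<in> tangent_space A q"
        using tangent_space_eq_range[OF A U(1) q(1)] by blast
      from eq[OF this] show ?thesis using a b q(2) by (simp add: coordinate_vector_def)
    qed
    then have "(\<lambda>h. (frechet_derivative ?a (at y) h * ?b y - ?a y * frechet_derivative ?b (at y) h)
        / (?b y * ?b y)) = (\<lambda>h. 0)"
      using b0[of q] by (simp add: iq fun_eq_iff)
    with has_derivative_divide'[OF da db] b0
    have "((\<lambda>y. ?a y / ?b y) has_derivative (\<lambda>h. 0)) (at y)" by simp
    then show ?thesis by (rule has_derivative_at_withinI)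
  qed
  have const: "?a y / ?b y = a p / b p" if "y \<in> ball (\<phi> p) r" for y
  proof -
    obtain k where "\<And>y. y \<in> ball (\<phi> p) r \<Longrightarrow> ?a y / ?b y = k"
      using has_derivative_zero_constant[OF convex_ball der] by blast
    from this[OF that] this[of "\<phi> p"] show ?thesis
      using r(1) chart_inv[OF A U] by simp
  qed
  let ?T = "U \<inter> \<phi> -` ball (\<phi> p) r"
  have "open ?T"
    using homeomorphism_cont1[OF ch(3)] ch(1) by (rule continuous_open_preimage) simp
  moreover have "p \<in> ?T" using U(2) r(1) by simp
  moreover have "a q / b q = a p / b p" if "q \<in> ?T" for q
    using const[of "\<phi> q"] that chart_inv[OF A U(1), of q] by simp
  ultimately show thesis using that by blast
qed

theorem proposition3:
  fixes A :: "('m::{t2_space,second_countable_topology}, 'e::euclidean_space) chart set"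
    and n :: nat
    and g \<alpha> :: "'m tensor02"
    and D :: "'m connection"
    and \<xi> :: "'m vector_field"
  assumes "smooth_atlas A" and "DIM('e) = n + 1"
    and "pseudo_riemannian_metric A g"
    and "levi_civita_connection A g D"
    and "\<xi> \<in> vector_fields A"
    and "\<forall>p. g p (\<xi> p) (\<xi> p) \<noteq> 0"
    and "\<forall>p. jacobi_rank A D \<xi> p = n"
    and "quadratic_form_field A \<alpha>"
    and "parallel A D \<alpha>"
    and "\<exists>p. \<exists>u\<in>tangent_space A p. \<exists>v\<in>tangent_space A p. \<alpha> p u v \<noteq> 0"
  shows "\<exists>c :: 'm \<Rightarrow> real.
    (\<forall>C\<in>components UNIV. c constant_on C) \<and>
    (\<forall>p. \<forall>u\<in>tangent_space A p. \<forall>v\<in>tangent_space A p. \<alpha> p u v = c p * g p u v)"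
proof -
  note A = assms(1) and D = assms(4) and \<xi> = assms(5) and \<alpha> = assms(8) and par = assms(9)
  have g: "quadratic_form_field A g" using assms(3) unfolding pseudo_riemannian_metric_def by simp
  have parg: "parallel A D g" and aff: "affine_connection A D"
    using D unfolding levi_civita_connection_def by auto
  have ne: "g p (\<xi> p) (\<xi> p) \<noteq> 0" for p using assms(6) by simp
  define a where "a = (\<lambda>p. \<alpha> p (\<xi> p) (\<xi> p))"
  define b where "b = (\<lambda>p. g p (\<xi> p) (\<xi> p))"
  define F where "F p = insert (\<xi> p) ((\<lambda>X. jacobi_operator D \<xi> X p) ` vector_fields A)" for p
  have frame: "span (F p) = tangent_space A p" for p
  proof -
    have "DIM('e) \<le> jacobi_rank A D \<xi> p + 1" using assms(2,7) by simp
    from jacobi_frame[where p = p and g = g, OF A this g D \<xi> ne] show ?thesis by (simp only: F_def)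
  qed
  have proportional: "\<alpha> p u v = a p / b p * g p u v"
    if "u \<in> tangent_space A p" "v \<in> tangent_space A p" for p u v
    using parallel_form_pointwise_proportional[where p = p and g = g and \<alpha> = \<alpha>,
        OF A g D \<xi> ne frame[of p, unfolded F_def] \<alpha> par that]
    by (simp only: a_def b_def)
  have ab: "a \<in> smooth_functions A" "b \<in> smooth_functions A"
    using tensor02_smooth[OF quadratic_form_tensor[OF \<alpha>] \<xi> \<xi>]
      tensor02_smooth[OF quadratic_form_tensor[OF g] \<xi> \<xi>] 
    by (simp_all only: a_def b_def)
  \<comment> \<open>This is \<open>da = c db\<close> along global fields; the frame extends it to all tangent vectors.\<close>
  have field: "X p a = a p / b p * X p b" if X: "X \<in> vector_fields A" for X p
  proof -
    note t = vector_field_tangent[OF connection_vector_field[OF aff X \<xi>]] vector_field_tangent[OF \<xi>]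
    have "X p a = \<alpha> p (D X \<xi> p) (\<xi> p) + \<alpha> p (\<xi> p) (D X \<xi> p)"
      unfolding a_def by (rule parallel_derivative[OF par X \<xi> \<xi>])
    moreover have "X p b = g p (D X \<xi> p) (\<xi> p) + g p (\<xi> p) (D X \<xi> p)"
      unfolding b_def by (rule parallel_derivative[OF parg X \<xi> \<xi>])
    ultimately show ?thesis
      using proportional[OF t] proportional[OF t(2,1)] by (simp add: distrib_left)
  qed
  have tangent: "v a = a p / b p * v b" if "v \<in> tangent_space A p" for p v
  proof -
    have "subspace {v. v a = a p / b p * v b}"
      by (simp add: subspace_def scaleR_fun_def distrib_left add_divide_distrib)
    moreover have "F p \<subseteq> {v. v a = a p / b p * v b}"
      using field \<xi> curvature_vector_field[OF A D _ \<xi> \<xi>]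
      by (auto simp: F_def jacobi_operator_def)
    ultimately have "span (F p) \<subseteq> {v. v a = a p / b p * v b}" by (rule span_minimal[rotated])
    then show ?thesis using that frame by auto
  qed
  have "(\<lambda>p. a p / b p) constant_on C" if "C \<in> components UNIV" for C
  proof (rule locally_constant_imp_constant)
    show "connected C" using that by (rule in_components_connected)
    fix p assume p: "p \<in> C"
    obtain T where T: "open T" "p \<in> T" "\<And>q. q \<in> T \<Longrightarrow> a q / b q = a p / b p"
      using quotient_locally_constant[OF A ab _ tangent] ne b_def by metis
    then show "\<exists>T. openin (top_of_set C) T \<and> p \<in> T \<and> (\<forall>q\<in>T. a q / b q = a p / b p)"
      using p T(2,3) openin_open_Int[OF T(1), of C] by blast
  qed
  then show ?thesis using proportional by (intro exI[of _ "\<lambda>p. a p / b p"]) blast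
qed

end
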